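(* Let $n\ge 4$ be an integer, let $N=2^n$, and let $F\colon\mathbb F_2^n\to\mathbb F_2^n$ be an APN function. Denote by $\mathcal L_k(F)$ the $k$-th entry when the $N(N-1)$ numbers $|W_{f_b}(a)|$, indexed by $(a,b)\in\mathbb F_2^n\times(\mathbb F_2^n\setminus\{0\})$, are arranged in nonincreasing order, with repeated values retained. Then, for every integer $1\le k\le N(N-1)$, \[ \mathcal L_k(F)\le\frac{N}{\sqrt k}\sqrt{1+\frac{2^{k-1}-1}{N}}. \] Moreover, \[ \mathcal L_2(F)\le 2\left\lfloor\frac N3\right\rfloor<\frac{2N}{3}, \qquad \mathcal L_4(F)\le\frac N2. \]
   Context: A function $F\colon\mathbb F_2^n\to\mathbb F_2^n$ is almost perfect nonlinear (APN) if for every $h\in\mathbb F_2^n\setminus\{0\}$ and every $y\in\mathbb F_2^n$ the equation $F(x+h)+F(x)=y$ has at most two solutions $x\in\mathbb F_2^n$. For $b\in\mathbb F_2^n$ let $f_b=b\cdot F\colon\mathbb F_2^n\to\mathbb F_2$, where $\cdot$ is the usual dot product over $\mathbb F_2$. For a Boolean function $f\colon\mathbb F_2^n\to\mathbb F_2$ the Walsh transform is $W_f(a)=\sum_{x\in\mathbb F_2^n}(-1)^{f(x)+a\cdot x}$ for $a\in\mathbb F_2^n$. *)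

theory Defs
  imports "HOL-Analysis.Finite_Cartesian_Product" "HOL-Library.Z2" "HOL-Library.Multiset"
begin

text \<open>
  The space $\mathbb{F}_2^n$ is the type \<open>bit ^ 'n\<close> with \<open>n = CARD('n)\<close>.
\<close>

instance bit :: finite
proof
  have "(UNIV :: bit set) = {0, 1}"
    using bit.exhaust by blast
  then show "finite (UNIV :: bit set)"
    by (metis finite.emptyI finite.insertI)
qed

definition dot :: "bit ^ 'n \<Rightarrow> bit ^ 'n \<Rightarrow> bit" where
  "dot a x = (\<Sum>i\<in>UNIV. a $ i * x $ i)"

definition APN :: "(bit ^ 'n \<Rightarrow> bit ^ 'n) \<Rightarrow> bool" where
  "APN F \<longleftrightarrow> (\<forall>h y. h \<noteq> 0 \<longrightarrow> card {x. F (x + h) + F x = y} \<le> 2)"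

definition component :: "(bit ^ 'n \<Rightarrow> bit ^ 'n) \<Rightarrow> bit ^ 'n \<Rightarrow> bit ^ 'n \<Rightarrow> bit" where
  "component F b = (\<lambda>x. dot b (F x))"

text \<open>In the exponent, \<open>of_bit\<close> lifts an element of \<open>bit\<close> to the natural number 0 or 1.\<close>

definition Walsh :: "(bit ^ 'n \<Rightarrow> bit) \<Rightarrow> bit ^ 'n \<Rightarrow> int" where
  "Walsh f a = (\<Sum>x\<in>UNIV. (- 1) ^ (of_bit (f x + dot a x) :: nat))"

text \<open>
  The multiset of the numbers $|W_{f_b}(a)|$ keeps one copy for each pair $(a,b)$ with $b \neq 0$.
\<close>

definition Walsh_spectrum :: "(bit ^ 'n \<Rightarrow> bit ^ 'n) \<Rightarrow> int multiset" where
  "Walsh_spectrum F =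
     image_mset (\<lambda>(a, b). \<bar>Walsh (component F b) a\<bar>) (mset_set (UNIV \<times> (UNIV - {0})))"

text \<open>
  The \<open>k\<close>-th largest entry, with \<open>k\<close> counted from 1; this is meaningful only for
  \<open>1 \<le> k \<le> N * (N - 1)\<close> where \<open>N = 2 ^ CARD('n)\<close> (see \<open>size_Walsh_spectrum\<close>).
\<close>

definition kth_largest :: "nat \<Rightarrow> (bit ^ 'n \<Rightarrow> bit ^ 'n) \<Rightarrow> int" where
  "kth_largest k F = rev (sorted_list_of_multiset (Walsh_spectrum F)) ! (k - 1)"

lemma card_bit: "CARD(bit) = 2"
proof -
  have "(UNIV :: bit set) = {0, 1}"
    using bit.exhaust by blast
  then have "CARD(bit) = card {0 :: bit, 1}"
    by (rule arg_cong)
  then show ?thesis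
    by simp
qed

lemma size_Walsh_spectrum:
  fixes F :: "bit ^ 'n \<Rightarrow> bit ^ 'n"
  shows "size (Walsh_spectrum F) = 2 ^ CARD('n) * (2 ^ CARD('n) - 1)"
proof -
  have "CARD(bit ^ 'n) = 2 ^ CARD('n)"
    by (simp add: card_bit CARD_vec)
  then show ?thesis
    by (simp add: Walsh_spectrum_def card_cartesian_product card_Diff_singleton)
qed

end

theory Submission
  imports Defs
begin

text \<open>
  Let \<open>N = 2\<^sup>n\<close>. For \<open>c = (a, b)\<close> the number \<open>W(c) = W\<^bsub>f_b\<^esub>(a)\<close> is the sum of the character
  \<open>z \<mapsto> (-1)\<^bsup>c \<cdot> z\<^esup>\<close> of \<open>\<bbbF>\<^sub>2\<^sup>n \<times> \<bbbF>\<^sub>2\<^sup>n\<close> over the graph \<open>{(x, F x)}\<close>. The function \<open>F\<close> is APN exactly when the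
  graph is a Sidon set: every difference with nonzero first coordinate comes from at most two
  ordered pairs of graph points. Distinct graph points never differ by a vertical vector
  \<open>(0, y)\<close>.

  For a subspace \<open>V\<close>, orthogonality of characters gives \<open>\<Sum>\<^bsub>c \<in> V\<^esub> W(c)\<^sup>2 = |V| \<cdot> P\<close>, where \<open>P\<close> counts the ordered
  pairs of graph points whose difference lies in the annihilator of \<open>V\<close>. The annihilator has
  \<open>N\<^sup>2 / |V|\<close> elements, at least \<open>N / |V|\<close> of them vertical, so \<open>|V| \<cdot> P \<le> |V| N + 2 (N\<^sup>2 - N)\<close>.
  On a coset \<open>a + U\<close> with \<open>a \<notin> U\<close> the pairs are weighted by signs. Dropping the negative ones
  leaves the pairs counted for \<open>V = U \<union> (a + U)\<close>, which has twice as many elements as \<open>U\<close>;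
  hence \<open>\<Sum>\<^bsub>c \<in> a + U\<^esub> W(c)\<^sup>2 \<le> |U| N + N\<^sup>2 - N\<close>.

  Now let \<open>A\<close> consist of \<open>k\<close> nonzero vectors. Their differences lie in a subspace \<open>U\<close> with
  at most \<open>2\<^bsup>k-1\<^esup>\<close> elements (lemma \<open>difference_hull\<close>), so \<open>A\<close> lies in a single coset of \<open>U\<close>. If this coset
  is proper, the coset bound applies; if it is \<open>U\<close> itself, the subspace bound applies after
  removing the term \<open>W(0)\<^sup>2 = N\<^sup>2\<close>. Either way \<open>\<Sum>\<^bsub>c \<in> A\<^esub> W(c)\<^sup>2 \<le> N\<^sup>2 + N (2\<^bsup>k-1\<^esup> - 1)\<close>
  (lemma \<open>sum_walsh_square_le\<close>). Taking for \<open>A\<close> the indices of the \<open>k\<close> largest values bounds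
  \<open>k \<L>\<^sub>k(F)\<^sup>2\<close> by the right-hand side. For \<open>k = 4\<close> this leaves \<open>\<L>\<^sub>4(F) < N/2 + 2\<close>, and
  both \<open>\<L>\<^sub>4(F)\<close> and \<open>N/2\<close> are even.

  For \<open>k = 2\<close> a third value helps: if \<open>W(c)\<close> and \<open>W(d)\<close> are both large, the two characters agree up to a
  sign on much of the graph, so \<open>|W(c + d)| \<ge> |W(c)| + |W(d)| - N\<close>. Inserting this into the subspace bound
  for \<open>{0, c, d, c + d}\<close> gives \<open>L (3 L - 2 N) \<le> N\<close> for \<open>L = \<L>\<^sub>2(F)\<close>, and parity of \<open>L\<close> excludes \<open>3 L > 2 N\<close>.
\<close>

section \<open>Characters of the plane \<open>\<bbbF>\<^sub>2\<^sup>n \<times> \<bbbF>\<^sub>2\<^sup>n\<close>\<close>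

type_synonym 'n plane = "(bit, 'n) vec \<times> (bit, 'n) vec"

text \<open>
  The removed rules rewrite sums and products in \<open>\<bbbF>\<^sub>2\<close> to bit operations, after which the ring laws
  no longer match.
\<close>

declare card_bit [simp] add_bit_eq_xor [simp del] mult_bit_eq_and [simp del]

definition chi :: "bit \<Rightarrow> int" where
  "chi t = (- 1) ^ (of_bit t :: nat)"

lemma chi_simps [simp]: "chi 0 = 1" "chi 1 = - 1"
  by (simp_all add: chi_def)

lemma chi_add: "chi (s + t) = chi s * chi t"
  by (cases s; cases t) simp_all

lemma odd_chi: "odd (chi t)"
  by (cases t) simp_all

lemma bit_add_self: "t + t = (0 :: bit)"
  by (cases t) simp_all

lemma bit_vec_add_self [simp]: "x + x = (0 :: bit ^ 'n)"
  by (simp add: vec_eq_iff bit_add_self)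

lemma bit_plane_add_self [simp]: "z + z = (0 :: 'n::finite plane)"
  by (simp add: prod_eq_iff)

lemma card_bit_vec: "CARD(bit ^ 'n) = 2 ^ CARD('n)"
  by (simp add: card_bit CARD_vec)

lemma dot_zero [simp]: "dot 0 x = 0" "dot a 0 = 0"
  by (simp_all add: dot_def)

lemma dot_add_left: "dot (a + b) x = dot a x + dot b x"
  by (simp add: dot_def distrib_right sum.distrib)

lemma dot_add_right: "dot a (x + y) = dot a x + dot a y"
  by (simp add: dot_def distrib_left sum.distrib)

lemma dot_nondegenerate:
  assumes "a \<noteq> (0 :: bit ^ 'n)"
  shows "\<exists>x. dot a x \<noteq> 0"
proof -
  obtain i where i: "a $ i \<noteq> 0"
    using assms by (auto simp: vec_eq_iff)
  have "dot a (axis i 1) = (\<Sum>j\<in>UNIV. if j = i then a $ i else 0)"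
    unfolding dot_def by (rule sum.cong) (auto simp: axis_def)
  then have "dot a (axis i 1) = a $ i"
    by simp
  then show ?thesis
    using i by metis
qed

definition pairing :: "'n::finite plane \<Rightarrow> 'n::finite plane \<Rightarrow> bit" where
  "pairing c z = dot (fst c) (fst z) + dot (snd c) (snd z)"

lemma pairing_add_left: "pairing (c + d) z = pairing c z + pairing d z"
  by (simp add: pairing_def dot_add_left algebra_simps)

lemma pairing_add_right: "pairing c (z + w) = pairing c z + pairing c w"
  by (simp add: pairing_def dot_add_right algebra_simps)

lemma pairing_zero_left [simp]: "pairing 0 z = 0"
  by (simp add: pairing_def)

lemma pairing_zero_right [simp]: "pairing c 0 = 0"
  by (simp add: pairing_def)

lemma pairing_nondegenerate:
  assumes "\<And>z. pairing c z = 0"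
  shows "c = 0"
proof -
  have "dot (fst c) x = 0" for x
    using assms[of "(x, 0)"] by (simp add: pairing_def)
  moreover have "dot (snd c) x = 0" for x
    using assms[of "(0, x)"] by (simp add: pairing_def)
  ultimately show ?thesis
    using dot_nondegenerate[of "fst c"] dot_nondegenerate[of "snd c"]
    by (auto simp: prod_eq_iff)
qed

text \<open>
Over \<open>\<bbbF>\<^sub>2\<close> the only scalars are 0 and 1, so these are exactly the linear subspaces.
\<close>

definition subspace2 :: "'a::ab_group_add set \<Rightarrow> bool" where
  "subspace2 U \<longleftrightarrow> 0 \<in> U \<and> (\<forall>x\<in>U. \<forall>y\<in>U. x + y \<in> U)"

lemma subspace2_UNIV: "subspace2 UNIV"
  by (simp add: subspace2_def)

text \<open>
  If \<open>\<phi> d = 1\<close> for some \<open>d \<in> U\<close>, translation by \<open>d\<close> permutes \<open>U\<close> and changes the sign of every term,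
  so the sum vanishes.
\<close>

lemma sum_chi_subspace:
  fixes U :: "'a::ab_group_add set" and \<phi> :: "'a \<Rightarrow> bit"
  assumes fin: "finite U" and U: "subspace2 U"
    and self: "\<And>x :: 'a. x + x = 0"
    and add: "\<And>x y. \<phi> (x + y) = \<phi> x + \<phi> y"
  shows "(\<Sum>c\<in>U. chi (\<phi> c)) = (if \<forall>c\<in>U. \<phi> c = 0 then int (card U) else 0)"
proof (cases "\<forall>c\<in>U. \<phi> c = 0")
  case True
  then show ?thesis by simp
next
  case False
  then obtain d where d: "d \<in> U" "\<phi> d = 1"
    by (metis bit.exhaust)
  have "bij_betw (\<lambda>c. d + c) U U"
    by (rule bij_betw_byWitness[where f' = "\<lambda>c. d + c"])
       (use d U self in \<open>auto simp: subspace2_def add.assoc[symmetric]\<close>)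
  then have "(\<Sum>c\<in>U. chi (\<phi> c)) = (\<Sum>c\<in>U. chi (\<phi> (d + c)))"
    by (rule sum.reindex_bij_betw[symmetric])
  also have "\<dots> = - (\<Sum>c\<in>U. chi (\<phi> c))"
    by (simp add: add chi_add d sum_negf)
  finally have "(\<Sum>c\<in>U. chi (\<phi> c)) = 0" by linarith
  with False show ?thesis by (simp only: if_False)
qed

section \<open>Annihilators\<close>

definition annihilator :: "('n::finite plane) set \<Rightarrow> ('n::finite plane) set" where
  "annihilator V = {z. \<forall>c\<in>V. pairing c z = 0}"

lemma sum_chi_pairing:
  fixes V :: "('n::finite plane) set"
  assumes "subspace2 V"
  shows "(\<Sum>c\<in>V. chi (pairing c z)) = (if z \<in> annihilator V then int (card V) else 0)"
  using sum_chi_subspace[of V "\<lambda>c. pairing c z"] assms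
  by (simp add: pairing_add_left annihilator_def)

text \<open>
  Double counting: summing \<open>(-1)\<^bsup>c \<cdot> z\<^esup>\<close> over \<open>c \<in> V\<close> first detects the annihilator, and summing over
  \<open>z\<close> first detects \<open>c = 0\<close>.
\<close>

lemma card_annihilator:
  fixes V :: "('n::finite plane) set"
  assumes V: "subspace2 V"
  shows "int (card V) * int (card (annihilator V)) = (2 ^ CARD('n))\<^sup>2"
proof -
  have "int (card V) * int (card (annihilator V)) = (\<Sum>z\<in>UNIV. \<Sum>c\<in>V. chi (pairing c z))"
    by (simp add: sum_chi_pairing[OF V] sum.If_cases)
  also have "\<dots> = (\<Sum>c\<in>V. \<Sum>z\<in>UNIV. chi (pairing c z))"
    by (rule sum.swap)
  also have "\<dots> = (\<Sum>c\<in>V. if c = 0 then int CARD('n::finite plane) else 0)"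
  proof (rule sum.cong)
    fix c :: "'n::finite plane"
    have "(\<forall>z. pairing c z = 0) \<longleftrightarrow> c = 0"
      by (metis pairing_nondegenerate pairing_zero_left)
    then show "(\<Sum>z\<in>UNIV. chi (pairing c z)) =
        (if c = 0 then int CARD('n::finite plane) else 0)"
      using sum_chi_subspace[OF _ subspace2_UNIV, of "\<lambda>z. pairing c z"]
      by (simp add: pairing_add_right)
  qed simp
  also have "\<dots> = int CARD('n::finite plane)"
    using V by (simp add: subspace2_def)
  finally show ?thesis
    by (simp add: card_bit_vec power2_eq_square)
qed

text \<open>
  The same double counting over the vertical vectors \<open>(0, y)\<close>. Here every \<open>c = (a, 0)\<close> in \<open>V\<close> contributes
  \<open>N\<close>, which is why only an inequality results; the term \<open>c = 0\<close> alone accounts for the bound.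
\<close>

lemma card_annihilator_vertical:
  fixes V :: "('n::finite plane) set"
  assumes V: "subspace2 V"
  shows "2 ^ CARD('n) \<le> int (card V) * int (card {z \<in> annihilator V. fst z = 0})"
proof -
  have eq: "{z \<in> annihilator V. fst z = 0} = Pair 0 ` {y. (0, y) \<in> annihilator V}"
    by force
  have card_eq: "card {z \<in> annihilator V. fst z = 0} = card {y. (0, y) \<in> annihilator V}"
    unfolding eq by (rule card_image) (simp add: inj_on_def)
  have "2 ^ CARD('n) = (\<Sum>c\<in>{0 :: 'n::finite plane}. \<Sum>y\<in>UNIV. chi (pairing c (0, y)))"
    by (simp add: card_bit_vec)
  also have "\<dots> \<le> (\<Sum>c\<in>V. \<Sum>y\<in>UNIV. chi (pairing c (0, y)))"
  proof (rule sum_mono2)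
    fix c :: "'n::finite plane"
    show "0 \<le> (\<Sum>y\<in>UNIV. chi (pairing c (0, y)))"
      by (subst sum_chi_subspace[OF _ subspace2_UNIV])
         (simp_all add: pairing_def dot_add_right)
  qed (use V in \<open>auto simp: subspace2_def\<close>)
  also have "\<dots> = (\<Sum>y\<in>UNIV. \<Sum>c\<in>V. chi (pairing c (0, y)))"
    by (rule sum.swap)
  also have "\<dots> = int (card V) * int (card {y. (0, y) \<in> annihilator V})"
    by (simp add: sum_chi_pairing[OF V] sum.If_cases)
  finally show ?thesis by (simp add: card_eq)
qed

section \<open>The graph of an APN function is a Sidon set\<close>

definition graph_point :: "(bit ^ 'n \<Rightarrow> bit ^ 'n) \<Rightarrow> bit ^ 'n \<Rightarrow> 'n::finite plane" where
  "graph_point F x = (x, F x)"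

text \<open>
  A pair of arguments stands for the pair of graph points above them. Differences are sums,
  since the characteristic is 2.
\<close>

definition difference_pairs ::
    "(bit ^ 'n \<Rightarrow> bit ^ 'n) \<Rightarrow> ('n::finite plane) set \<Rightarrow> ('n::finite plane) set" where
  "difference_pairs F D = {(x, y). graph_point F x + graph_point F y \<in> D}"

text \<open>
  A pair \<open>(x, x + h)\<close> with \<open>h \<noteq> 0\<close> and difference \<open>(h, y)\<close> is determined by that difference and by a solution
  \<open>x\<close> of \<open>F (x + h) + F x = y\<close>, and the APN property leaves at most two such \<open>x\<close>. The diagonal pairs
  contribute the summand \<open>N\<close>.
\<close>

lemma card_difference_pairs_le:
  fixes F :: "bit ^ 'n \<Rightarrow> bit ^ 'n"
  assumes "APN F"
  shows "card (difference_pairs F D) \<le> 2 ^ CARD('n) + 2 * card {z \<in> D. fst z \<noteq> 0}"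
proof -
  let ?S = "\<lambda>z. {x. F (x + fst z) + F x = snd z}"
  let ?E = "{z \<in> D. fst z \<noteq> 0}"
  have "difference_pairs F D \<subseteq> range (\<lambda>x. (x, x)) \<union> (\<Union>z\<in>?E. (\<lambda>x. (x, x + fst z)) ` ?S z)"
  proof
    fix p assume p: "p \<in> difference_pairs F D"
    obtain x y where xy: "p = (x, y)" by (cases p)
    define z where "z = graph_point F x + graph_point F y"
    have z: "z \<in> D"
      using p by (simp add: xy difference_pairs_def z_def)
    have y: "y = x + fst z"
      by (simp add: z_def graph_point_def add.assoc[symmetric])
    have x: "x \<in> ?S z"
      using y by (simp add: z_def graph_point_def add.commute)
    show "p \<in> range (\<lambda>x. (x, x)) \<union> (\<Union>z\<in>?E. (\<lambda>x. (x, x + fst z)) ` ?S z)"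
    proof (cases "fst z = 0")
      case True
      then show ?thesis using xy y by simp
    next
      case False
      then have "z \<in> ?E" using z by simp
      moreover have "p \<in> (\<lambda>x. (x, x + fst z)) ` ?S z"
        using x unfolding xy by (subst y) (rule imageI)
      ultimately show ?thesis by blast
    qed
  qed
  then have "card (difference_pairs F D) \<le>
      card (range (\<lambda>x :: bit ^ 'n. (x, x)) \<union> (\<Union>z\<in>?E. (\<lambda>x. (x, x + fst z)) ` ?S z))"
    by (rule card_mono[rotated]) simp
  also have "\<dots> \<le> card (range (\<lambda>x :: bit ^ 'n. (x, x))) +
      (\<Sum>z\<in>?E. card ((\<lambda>x. (x, x + fst z)) ` ?S z))"
    by (rule order_trans[OF card_Un_le]) (simp add: card_UN_le)
  also have "\<dots> \<le> 2 ^ CARD('n) + (\<Sum>z\<in>?E. 2)"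
  proof (rule add_mono)
    show "card (range (\<lambda>x :: bit ^ 'n. (x, x))) \<le> 2 ^ CARD('n)"
      using card_image_le[of "UNIV :: (bit ^ 'n) set" "\<lambda>x. (x, x)"] by (simp add: card_bit_vec)
    show "(\<Sum>z\<in>?E. card ((\<lambda>x. (x, x + fst z)) ` ?S z)) \<le> (\<Sum>z\<in>?E. 2)"
    proof (rule sum_mono)
      fix z assume "z \<in> ?E"
      then have "card (?S z) \<le> 2"
        using assms by (simp add: APN_def)
      then show "card ((\<lambda>x. (x, x + fst z)) ` ?S z) \<le> 2"
        using card_image_le[of "?S z" "\<lambda>x. (x, x + fst z)"] by simp
    qed
  qed
  finally show ?thesis by simp
qed

lemma card_difference_pairs_annihilator_le:
  fixes F :: "bit ^ 'n \<Rightarrow> bit ^ 'n"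
  assumes "APN F" and V: "subspace2 V"
  defines "N \<equiv> (2 ^ CARD('n) :: int)"
  shows "int (card V) * int (card (difference_pairs F (annihilator V)))
    \<le> int (card V) * N + 2 * (N\<^sup>2 - N)"
proof -
  let ?h = "card {z \<in> annihilator V. fst z = 0}" and ?g = "card {z \<in> annihilator V. fst z \<noteq> 0}"
  have "annihilator V = {z \<in> annihilator V. fst z = 0} \<union> {z \<in> annihilator V. fst z \<noteq> 0}"
    by auto
  then have split: "card (annihilator V) = ?h + ?g"
    by (metis (no_types, lifting) card_Un_disjoint finite disjoint_iff mem_Collect_eq)
  have "int (card V) * int ?h + int (card V) * int ?g = N\<^sup>2"
    using card_annihilator[OF V] by (simp add: split N_def algebra_simps)
  then have *: "int (card V) * int ?g \<le> N\<^sup>2 - N"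
    using card_annihilator_vertical[OF V] by (simp add: N_def)
  have "int (card (difference_pairs F (annihilator V))) \<le> N + 2 * int ?g"
    using card_difference_pairs_le[OF assms(1), of "annihilator V"] unfolding N_def
    by (metis (mono_tags, lifting) of_nat_add of_nat_le_iff of_nat_mult of_nat_numeral of_nat_power)
  then have "int (card V) * int (card (difference_pairs F (annihilator V)))
      \<le> int (card V) * (N + 2 * int ?g)"
    by (rule mult_left_mono) simp
  then show ?thesis
    using * by (simp add: algebra_simps)
qed

section \<open>Second moments of the Walsh transform over cosets\<close>

definition walsh :: "(bit ^ 'n \<Rightarrow> bit ^ 'n) \<Rightarrow> 'n::finite plane \<Rightarrow> int" where
  "walsh F c = (\<Sum>x\<in>UNIV. chi (pairing c (graph_point F x)))"

lemma Walsh_component: "Walsh (component F b) a = walsh F (a, b)"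
  by (simp add: Walsh_def walsh_def component_def chi_def pairing_def graph_point_def add.commute)

lemma walsh_zero: "walsh (F :: bit ^ 'n \<Rightarrow> bit ^ 'n) 0 = 2 ^ CARD('n)"
  by (simp add: walsh_def card_bit_vec)

lemma even_walsh: "even (walsh F c)"
  for F :: "bit ^ 'n \<Rightarrow> bit ^ 'n"
proof -
  have "even (\<Sum>x\<in>(UNIV :: (bit ^ 'n) set). chi (pairing c (graph_point F x)) - 1)"
    by (rule dvd_sum) (simp add: odd_chi)
  then have "even (walsh F c - 2 ^ CARD('n))"
    by (simp add: walsh_def sum_subtractf card_bit_vec)
  then show ?thesis
    by simp
qed

text \<open>
  Expanding the square gives a sum over pairs of graph points, and summing over \<open>c \<in> U\<close> keeps
  only the pairs whose difference is orthogonal to \<open>U\<close>.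
\<close>

lemma sum_walsh_coset:
  assumes U: "subspace2 U"
  shows "(\<Sum>c\<in>U. (walsh F (a + c))\<^sup>2) =
    int (card U) *
      (\<Sum>(x, y)\<in>difference_pairs F (annihilator U).
        chi (pairing a (graph_point F x + graph_point F y)))"
proof -
  let ?d = "\<lambda>(x, y). graph_point F x + graph_point F y"
  have sq: "(walsh F c)\<^sup>2 = (\<Sum>p\<in>UNIV. chi (pairing c (?d p)))" for c
  proof -
    have "(walsh F c)\<^sup>2 = (\<Sum>x\<in>UNIV. \<Sum>y\<in>UNIV. chi (pairing c (?d (x, y))))"
      by (simp add: walsh_def power2_eq_square sum_product pairing_add_right chi_add)
    then show ?thesis
      unfolding sum.cartesian_product by (simp add: case_prod_beta)
  qed
  have "(\<Sum>c\<in>U. (walsh F (a + c))\<^sup>2) =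
      (\<Sum>p\<in>UNIV. \<Sum>c\<in>U. chi (pairing (a + c) (?d p)))"
    unfolding sq by (rule sum.swap)
  also have "\<dots> = (\<Sum>p\<in>UNIV. chi (pairing a (?d p)) * (\<Sum>c\<in>U. chi (pairing c (?d p))))"
    by (simp only: pairing_add_left chi_add sum_distrib_left)
  also have "\<dots> = (\<Sum>p\<in>UNIV. if p \<in> difference_pairs F (annihilator U)
      then int (card U) * chi (pairing a (?d p)) else 0)"
    unfolding sum_chi_pairing[OF U] by (rule sum.cong) (auto simp: difference_pairs_def)
  also have "\<dots> = (\<Sum>p\<in>difference_pairs F (annihilator U). int (card U) * chi (pairing a (?d p)))"
    by (simp add: sum.If_cases)
  also have "\<dots> = int (card U) * (\<Sum>p\<in>difference_pairs F (annihilator U). chi (pairing a (?d p)))"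
    by (rule sum_distrib_left[symmetric])
  finally show ?thesis
    by (simp add: case_prod_beta)
qed

lemma sum_walsh_subspace_le:
  fixes F :: "bit ^ 'n \<Rightarrow> bit ^ 'n"
  assumes "APN F" and V: "subspace2 V"
  defines "N \<equiv> (2 ^ CARD('n) :: int)"
  shows "(\<Sum>c\<in>V. (walsh F c)\<^sup>2) \<le> int (card V) * N + 2 * (N\<^sup>2 - N)"
proof -
  have "(\<Sum>c\<in>V. (walsh F c)\<^sup>2) = int (card V) * int (card (difference_pairs F (annihilator V)))"
    using sum_walsh_coset[OF V, of F 0] by simp
  then show ?thesis
    using card_difference_pairs_annihilator_le[OF assms(1) V] by (simp add: N_def)
qed

lemma bit_plane_add_cancel [simp]: "a + (a + z) = (z :: 'n::finite plane)"
  by (simp add: add.assoc[symmetric])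

lemma subspace2_adjoin:
  fixes U :: "('n::finite plane) set"
  assumes U: "subspace2 U"
  shows "subspace2 (U \<union> (+) a ` U)"
proof -
  have mem: "x \<in> U \<union> (+) a ` U \<longleftrightarrow> x \<in> U \<or> a + x \<in> U" for x
    by (metis Un_iff bit_plane_add_cancel image_iff)
  have add: "x + y \<in> U" if "x \<in> U" "y \<in> U" for x y
    using U that by (simp add: subspace2_def)
  have closed: "x + y \<in> U \<or> a + (x + y) \<in> U"
    if x: "x \<in> U \<or> a + x \<in> U" and y: "y \<in> U \<or> a + y \<in> U" for x y
  proof -
    have "(a + x) + y = a + (x + y)" "x + (a + y) = a + (x + y)"
      by (simp_all only: ac_simps)
    moreover have "(a + x) + (a + y) = x + y"
      by (metis add.assoc add.commute bit_plane_add_cancel)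
    ultimately show ?thesis
      using x y add by metis
  qed
  show ?thesis
    unfolding subspace2_def
  proof (intro conjI ballI)
    show "0 \<in> U \<union> (+) a ` U"
      using U by (simp add: subspace2_def)
    fix x y assume "x \<in> U \<union> (+) a ` U" "y \<in> U \<union> (+) a ` U"
    then show "x + y \<in> U \<union> (+) a ` U"
      using closed[of x y] by (simp only: mem)
  qed
qed

text \<open>
  Compared with the bound for the subspace \<open>U\<close>, the term \<open>2 (N\<^sup>2 - N)\<close> is halved: after the negatively
  signed pairs are dropped, those left have differences in the annihilator of \<open>U \<union> (a + U)\<close>, a
  subspace twice as large.
\<close>

lemma sum_walsh_proper_coset_le:
  fixes F :: "bit ^ 'n \<Rightarrow> bit ^ 'n"
  assumes "APN F" and U: "subspace2 U" and "a \<notin> U"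
  defines "N \<equiv> (2 ^ CARD('n) :: int)"
  shows "(\<Sum>c\<in>U. (walsh F (a + c))\<^sup>2) \<le> int (card U) * N + N\<^sup>2 - N"
proof -
  let ?d = "\<lambda>(x, y). graph_point F x + graph_point F y"
  let ?V = "U \<union> (+) a ` U"
  have "U \<inter> (+) a ` U = {}"
  proof (rule ccontr)
    assume "U \<inter> (+) a ` U \<noteq> {}"
    then obtain u v where "u \<in> U" "v \<in> U" "u = a + v" by blast
    then have "u + v = a" by (simp add: add.assoc)
    with \<open>u \<in> U\<close> \<open>v \<in> U\<close> U \<open>a \<notin> U\<close> show False
      by (auto simp: subspace2_def)
  qed
  then have card_V: "card ?V = 2 * card U"
    by (simp add: card_Un_disjoint card_image)
  have in_V: "p \<in> difference_pairs F (annihilator ?V)"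
    if "p \<in> difference_pairs F (annihilator U)" "pairing a (?d p) = 0" for p
    using that by (auto simp: difference_pairs_def annihilator_def pairing_add_left)
  have "(\<Sum>p\<in>difference_pairs F (annihilator U). chi (pairing a (?d p)))
      \<le> (\<Sum>p\<in>difference_pairs F (annihilator U).
        if p \<in> difference_pairs F (annihilator ?V) then 1 else 0)"
  proof (rule sum_mono)
    fix p assume "p \<in> difference_pairs F (annihilator U)"
    then show "chi (pairing a (?d p)) \<le> (if p \<in> difference_pairs F (annihilator ?V) then 1 else 0)"
      using in_V[of p] by (cases "pairing a (?d p)") auto
  qed
  also have "\<dots> \<le> (\<Sum>p\<in>UNIV. if p \<in> difference_pairs F (annihilator ?V) then 1 else 0)"
    by (rule sum_mono2) auto
  also have "\<dots> = int (card (difference_pairs F (annihilator ?V)))"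
    by (simp add: sum.If_cases)
  finally have "int (card U) * (\<Sum>p\<in>difference_pairs F (annihilator U). chi (pairing a (?d p)))
      \<le> int (card U) * int (card (difference_pairs F (annihilator ?V)))"
    by (rule mult_left_mono) simp
  moreover have "2 * int (card U) * int (card (difference_pairs F (annihilator ?V)))
      \<le> 2 * int (card U) * N + 2 * (N\<^sup>2 - N)"
    using card_difference_pairs_annihilator_le[OF assms(1) subspace2_adjoin[OF U, of a]]
    by (simp add: card_V N_def)
  ultimately show ?thesis
    by (simp add: sum_walsh_coset[OF U] case_prod_beta)
qed

section \<open>Sums over arbitrary sets of characters\<close>

text \<open>
  Each new vector at most doubles the subspace: it suffices to adjoin its sum with one of the earlier
  vectors. This covers linearly dependent \<open>A\<close> without a separate argument.
\<close>

lemma difference_hull: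
  fixes A :: "('n::finite plane) set"
  assumes "finite A" "A \<noteq> {}"
  shows "\<exists>U. subspace2 U \<and> card U \<le> 2 ^ (card A - 1) \<and> (\<forall>a\<in>A. \<forall>b\<in>A. a + b \<in> U)"
  using assms
proof (induction A rule: finite_ne_induct)
  case (singleton a)
  show ?case
    by (rule exI[of _ "{0}"]) (simp add: subspace2_def)
next
  case (insert a A)
  obtain U where U: "subspace2 U" "card U \<le> 2 ^ (card A - 1)"
    and diff: "\<And>b c. b \<in> A \<Longrightarrow> c \<in> A \<Longrightarrow> b + c \<in> U"
    using insert.IH by metis
  obtain b where b: "b \<in> A" using insert.hyps by blast
  let ?U = "U \<union> (+) (a + b) ` U"
  have mixed: "a + c \<in> ?U" if "c \<in> A" for c
  proof -
    have "a + c = (a + b) + (b + c)"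
      by (simp add: add.assoc)
    then show ?thesis using diff[OF b that] by blast
  qed
  have "card ?U \<le> 2 * card U"
    using card_Un_le[of U "(+) (a + b) ` U"] card_image_le[of U "(+) (a + b)"] by simp
  also have "\<dots> \<le> 2 * 2 ^ (card A - 1)"
    using U by simp
  also have "\<dots> = 2 ^ (card (insert a A) - 1)"
    using insert.hyps by (simp add: card_gt_0_iff flip: power_Suc)
  finally have "card ?U \<le> 2 ^ (card (insert a A) - 1)" .
  moreover have "\<forall>c\<in>insert a A. \<forall>d\<in>insert a A. c + d \<in> ?U"
    using mixed diff U(1) by (auto simp: subspace2_def add.commute[of _ a])
  ultimately show ?case
    using subspace2_adjoin[OF U(1), of "a + b"] by blast
qed

text \<open>
  The set \<open>A\<close> lies in one coset of its difference hull \<open>U\<close>. When \<open>A \<subseteq> U\<close>, the weaker bound for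
  subspaces is still enough, because \<open>0 \<notin> A\<close> and the square \<open>W(0)\<^sup>2 = N\<^sup>2\<close> may be subtracted.
\<close>

lemma sum_walsh_square_le:
  fixes F :: "bit ^ 'n \<Rightarrow> bit ^ 'n"
  assumes "APN F" and "A \<noteq> {}" and "0 \<notin> A"
  defines "N \<equiv> (2 ^ CARD('n) :: int)"
  shows "(\<Sum>c\<in>A. (walsh F c)\<^sup>2) \<le> N\<^sup>2 + N * (2 ^ (card A - 1) - 1)"
proof -
  define P :: int where "P = 2 ^ (card A - 1)"
  obtain U where U: "subspace2 U" "card U \<le> 2 ^ (card A - 1)"
    and diff: "\<And>b c. b \<in> A \<Longrightarrow> c \<in> A \<Longrightarrow> b + c \<in> U"
    using difference_hull[of A] assms by auto
  have "int (card U) \<le> 2 ^ (card A - 1)"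
    using U(2) by (metis of_nat_le_iff of_nat_numeral of_nat_power)
  then have cardU: "int (card U) * N \<le> P * N"
    by (simp add: N_def P_def)
  have N: "0 < N" by (simp add: N_def)
  have target: "N\<^sup>2 + N * (2 ^ (card A - 1) - 1) = N\<^sup>2 + P * N - N"
    by (simp add: P_def algebra_simps)
  obtain a where a: "a \<in> A" using assms by blast
  show ?thesis
  proof (cases "a \<in> U")
    case True
    have "b \<in> U" if "b \<in> A" for b
      using U(1) True diff[OF a that] bit_plane_add_cancel[of a b] by (metis subspace2_def)
    then have "insert 0 A \<subseteq> U"
      using U(1) by (auto simp: subspace2_def)
    then have "(\<Sum>c\<in>insert 0 A. (walsh F c)\<^sup>2) \<le> (\<Sum>c\<in>U. (walsh F c)\<^sup>2)"
      by (intro sum_mono2) auto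
    then have "N\<^sup>2 + (\<Sum>c\<in>A. (walsh F c)\<^sup>2) \<le> int (card U) * N + 2 * N\<^sup>2 - 2 * N"
      using sum_walsh_subspace_le[OF assms(1) U(1)] \<open>0 \<notin> A\<close>
      by (simp add: walsh_zero N_def right_diff_distrib)
    then show ?thesis
      using cardU N unfolding target by linarith
  next
    case False
    have "A \<subseteq> (+) a ` U"
      using diff[OF a] bit_plane_add_cancel by (metis image_eqI subsetI)
    then have "(\<Sum>c\<in>A. (walsh F c)\<^sup>2) \<le> (\<Sum>c\<in>(+) a ` U. (walsh F c)\<^sup>2)"
      by (intro sum_mono2) auto
    also have "\<dots> = (\<Sum>c\<in>U. (walsh F (a + c))\<^sup>2)"
      by (simp add: sum.reindex)
    also have "\<dots> \<le> int (card U) * N + N\<^sup>2 - N"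
      using sum_walsh_proper_coset_le[OF assms(1) U(1) False] by (simp add: N_def)
    finally show ?thesis
      using cardU unfolding target by linarith
  qed
qed

text \<open>
  For signs \<open>s\<close> and \<open>t\<close> the product \<open>(1 - s \<chi>\<^sub>c(z)) (1 - t \<chi>\<^sub>d(z))\<close> is nonnegative; summing it over the graph
  and choosing \<open>s\<close> and \<open>t\<close> as the signs of \<open>W(c)\<close> and \<open>W(d)\<close> gives the bound.
\<close>

lemma walsh_pair_le:
  fixes F :: "bit ^ 'n \<Rightarrow> bit ^ 'n"
  shows "\<bar>walsh F c\<bar> + \<bar>walsh F d\<bar> \<le> 2 ^ CARD('n) + \<bar>walsh F (c + d)\<bar>"
proof -
  let ?c = "\<lambda>x. chi (pairing c (graph_point F x))" and ?d = "\<lambda>x. chi (pairing d (graph_point F x))"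
  have pos: "s * walsh F c + t * walsh F d \<le> 2 ^ CARD('n) + \<bar>walsh F (c + d)\<bar>"
    if s: "s \<in> {1, - 1}" and t: "t \<in> {1, - 1}" for s t :: int
  proof -
    have "0 \<le> (\<Sum>x\<in>UNIV. (1 - s * ?c x) * (1 - t * ?d x))"
    proof (rule sum_nonneg)
      fix x
      have *: "0 \<le> 1 - r * chi u" if "r \<in> {1, - 1}" for r u
        using that by (cases u) auto
      show "0 \<le> (1 - s * ?c x) * (1 - t * ?d x)"
        using *[OF s] *[OF t] by simp
    qed
    also have "\<dots> = 2 ^ CARD('n) - s * walsh F c - t * walsh F d + s * t * walsh F (c + d)"
      by (simp add: walsh_def pairing_add_left chi_add algebra_simps sum.distrib sum_subtractf
          sum_distrib_left card_bit_vec)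
    finally have "s * walsh F c + t * walsh F d \<le> 2 ^ CARD('n) + s * t * walsh F (c + d)"
      by simp
    moreover have "s * t * walsh F (c + d) \<le> \<bar>walsh F (c + d)\<bar>"
      using s t by auto
    ultimately show ?thesis by linarith
  qed
  show ?thesis
    using pos[of 1 1] pos[of 1 "-1"] pos[of "-1" 1] pos[of "-1" "-1"] by simp
qed

text \<open>
  The subspace bound for \<open>{0, c, d, c + d}\<close> reads \<open>W(c)\<^sup>2 + W(d)\<^sup>2 + W(c + d)\<^sup>2 \<le> N\<^sup>2 + 2 N\<close>, and here
  \<open>|W(c + d)| \<ge> 2 L - N\<close>. The assumption \<open>N \<le> 2 L\<close> makes this lower bound nonnegative, so that it
  may be squared.
\<close>

lemma walsh_two_le:
  fixes F :: "bit ^ 'n \<Rightarrow> bit ^ 'n"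
  assumes "APN F" "c \<noteq> 0" "d \<noteq> 0" "c \<noteq> d" and L: "L \<le> \<bar>walsh F c\<bar>" "L \<le> \<bar>walsh F d\<bar>"
  defines "N \<equiv> (2 ^ CARD('n) :: int)"
  assumes large: "N \<le> 2 * L"
  shows "L * (3 * L - 2 * N) \<le> N"
proof -
  let ?V = "{0, c, d, c + d}"
  have cd: "c + d \<noteq> 0" "c + d \<noteq> c" "c + d \<noteq> d"
  proof -
    show "c + d \<noteq> 0"
    proof
      assume "c + d = 0"
      then have "c + d + d = d" by simp
      then show False using \<open>c \<noteq> d\<close> by (simp add: add.assoc)
    qed
  qed (use assms in auto)
  have "subspace2 {0, c}"
    by (simp add: subspace2_def)
  moreover have "{0, c} \<union> (+) d ` {0, c} = ?V"
    by (auto simp: add.commute)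
  ultimately have "subspace2 ?V"
    using subspace2_adjoin[of "{0, c}" d] by simp
  moreover have "card ?V = 4"
    using cd assms(2-4) by auto
  ultimately have "(\<Sum>v\<in>?V. (walsh F v)\<^sup>2) \<le> 4 * N + 2 * (N\<^sup>2 - N)"
    using sum_walsh_subspace_le[OF assms(1), of ?V] by (simp add: N_def)
  also have "(\<Sum>v\<in>?V. (walsh F v)\<^sup>2) =
      N\<^sup>2 + (walsh F c)\<^sup>2 + (walsh F d)\<^sup>2 + (walsh F (c + d))\<^sup>2"
    using cd assms(2-4) by (auto simp: walsh_zero N_def)
  finally have "(walsh F c)\<^sup>2 + (walsh F d)\<^sup>2 + (walsh F (c + d))\<^sup>2 \<le> N\<^sup>2 + 2 * N"
    by simp
  moreover have N: "0 < N" by (simp add: N_def)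
  have "L\<^sup>2 \<le> (walsh F c)\<^sup>2" "L\<^sup>2 \<le> (walsh F d)\<^sup>2"
    using L large N by (auto simp: abs_le_square_iff[symmetric])
  moreover from this have "2 * L\<^sup>2 \<le> (walsh F c)\<^sup>2 + (walsh F d)\<^sup>2"
    by simp
  moreover have "(2 * L - N)\<^sup>2 \<le> (walsh F (c + d))\<^sup>2"
    using walsh_pair_le[of F c d] L large N by (auto simp: abs_le_square_iff[symmetric] N_def)
  ultimately have "2 * L\<^sup>2 + (2 * L - N)\<^sup>2 \<le> N\<^sup>2 + 2 * N"
    by (meson add_mono order_trans)
  then show ?thesis
    by (simp add: power2_eq_square algebra_simps)
qed

section \<open>Order statistics\<close>

lemma size_filter_ge_nth_largest:
  fixes M :: "int multiset"
  assumes "k < size M"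
  shows "k < size (filter_mset ((\<le>) (rev (sorted_list_of_multiset M) ! k)) M)"
proof -
  let ?xs = "rev (sorted_list_of_multiset M)"
  have M: "mset ?xs = M" by simp
  have k: "k < length ?xs"
    using assms by (metis M size_mset)
  have "\<forall>x\<in>set (take (Suc k) ?xs). ?xs ! k \<le> x"
  proof
    fix x assume "x \<in> set (take (Suc k) ?xs)"
    then obtain i where i: "i \<le> k" "x = ?xs ! i"
      by (auto simp: in_set_conv_nth less_Suc_eq_le)
    have "sorted_wrt (\<ge>) ?xs"
      by (simp add: sorted_wrt_rev)
    then show "?xs ! k \<le> x"
      using i k by (cases "i = k") (auto simp: sorted_wrt_iff_nth_less)
  qed
  then have "filter ((\<le>) (?xs ! k)) (take (Suc k) ?xs) = take (Suc k) ?xs"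
    by (simp add: filter_id_conv)
  then have "Suc k = length (filter ((\<le>) (?xs ! k)) (take (Suc k) ?xs))"
    using k by simp
  also have "\<dots> \<le> length (filter ((\<le>) (?xs ! k)) ?xs)"
    by (metis append_take_drop_id filter_append length_append le_add1)
  also have "\<dots> = size (filter_mset ((\<le>) (?xs ! k)) M)"
    by (metis M mset_filter size_mset)
  finally show ?thesis by simp
qed

text \<open>
  This passes from the sorted list of values, which may repeat, to distinct indices, as needed
  for the sums over sets above.
\<close>

lemma kth_largest_witnesses:
  fixes F :: "bit ^ 'n \<Rightarrow> bit ^ 'n"
  assumes "1 \<le> k" "k \<le> 2 ^ CARD('n) * (2 ^ CARD('n) - 1)"
  obtains A where "card A = k" "0 \<notin> A" "\<And>c. c \<in> A \<Longrightarrow> kth_largest k F \<le> \<bar>walsh F c\<bar>"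
proof -
  let ?I = "UNIV \<times> (UNIV - {0}) :: ('n::finite plane) set"
  let ?B = "{c \<in> ?I. kth_largest k F \<le> \<bar>walsh F c\<bar>}"
  have spec: "Walsh_spectrum F = image_mset (\<lambda>c. \<bar>walsh F c\<bar>) (mset_set ?I)"
    by (simp add: Walsh_spectrum_def Walsh_component case_prod_unfold)
  have "k - 1 < size (Walsh_spectrum F)"
    using assms by (simp add: size_Walsh_spectrum)
  from size_filter_ge_nth_largest[OF this]
  have "k \<le> size (filter_mset ((\<le>) (kth_largest k F)) (Walsh_spectrum F))"
    by (simp add: kth_largest_def)
  also have "\<dots> = card ?B"
    by (simp add: spec filter_mset_image_mset)
  finally obtain A where "A \<subseteq> ?B" "card A = k"
    by (meson obtain_subset_with_card_n)
  then show ?thesis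
    by (intro that[of A]) (auto simp: zero_prod_def)
qed

text \<open>
Being an entry of the spectrum, the value is itself some \<open>|W(c)|\<close>, and every \<open>W(c)\<close> is even.
\<close>

lemma kth_largest_even_nonneg:
  fixes F :: "bit ^ 'n \<Rightarrow> bit ^ 'n"
  assumes "1 \<le> k" "k \<le> 2 ^ CARD('n) * (2 ^ CARD('n) - 1)"
  shows "even (kth_largest k F)" "0 \<le> kth_largest k F"
proof -
  have "k - 1 < length (rev (sorted_list_of_multiset (Walsh_spectrum F)))"
    using assms size_Walsh_spectrum[of F] by (metis (no_types, lifting) One_nat_def Suc_pred
      length_rev less_le_trans lessI mset_sorted_list_of_multiset not_one_le_zero size_mset
      zero_less_iff_neq_zero)
  then have "kth_largest k F \<in> set (rev (sorted_list_of_multiset (Walsh_spectrum F)))"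
    unfolding kth_largest_def by (rule nth_mem)
  then have "kth_largest k F \<in># Walsh_spectrum F"
    by simp
  then obtain c where "kth_largest k F = \<bar>walsh F c\<bar>"
    by (auto simp: Walsh_spectrum_def Walsh_component)
  then show "even (kth_largest k F)" "0 \<le> kth_largest k F"
    by (simp_all add: even_walsh)
qed

lemma kth_largest_square_le:
  fixes F :: "bit ^ 'n \<Rightarrow> bit ^ 'n"
  assumes "APN F" "1 \<le> k" "k \<le> 2 ^ CARD('n) * (2 ^ CARD('n) - 1)"
  defines "N \<equiv> (2 ^ CARD('n) :: int)"
  shows "int k * (kth_largest k F)\<^sup>2 \<le> N\<^sup>2 + N * (2 ^ (k - 1) - 1)"
proof -
  obtain A where A: "card A = k" "0 \<notin> A" "\<And>c. c \<in> A \<Longrightarrow> kth_largest k F \<le> \<bar>walsh F c\<bar>"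
    using kth_largest_witnesses assms by metis
  have "int k * (kth_largest k F)\<^sup>2 = (\<Sum>c\<in>A. (kth_largest k F)\<^sup>2)"
    using A by simp
  also have "\<dots> \<le> (\<Sum>c\<in>A. (walsh F c)\<^sup>2)"
    using A kth_largest_even_nonneg(2)[OF assms(2,3), of F]
    by (intro sum_mono) (auto simp: abs_le_square_iff[symmetric])
  also have "\<dots> \<le> N\<^sup>2 + N * (2 ^ (k - 1) - 1)"
    using sum_walsh_square_le[OF assms(1), of A] A assms(2) by (force simp: N_def)
  finally show ?thesis .
qed

theorem theorem1p2:
  fixes F :: "bit ^ 'n \<Rightarrow> bit ^ 'n" and N :: nat
  assumes "CARD('n) \<ge> 4"
    and "N = 2 ^ CARD('n)"
    and "APN F"
  shows "(\<forall>k. 1 \<le> k \<and> k \<le> N * (N - 1) \<longrightarrow>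
            real_of_int (kth_largest k F)
              \<le> real N / sqrt (real k) * sqrt (1 + (2 ^ (k - 1) - 1) / real N))
       \<and> kth_largest 2 F \<le> 2 * \<lfloor>real N / 3\<rfloor>
       \<and> real_of_int (2 * \<lfloor>real N / 3\<rfloor>) < 2 * real N / 3
       \<and> real_of_int (kth_largest 4 F) \<le> real N / 2"
proof (intro conjI allI impI)
  have N16: "16 \<le> N"
    using power_increasing[OF assms(1), of "2 :: nat"] assms(2) by simp
  have N_int: "int N = 2 ^ CARD('n)"
    by (simp add: assms(2))
  have big: "N \<le> N * (N - 1)"
    using N16 by simp
  have range: "k \<le> 2 ^ CARD('n) * (2 ^ CARD('n) - 1)" if "k \<le> 16" for k :: nat
    using order_trans[OF order_trans[OF that N16] big] by (simp only: assms(2))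
  have not3: "\<not> 3 dvd int N"
  proof -
    have "coprime (3 :: int) 2"
      using coprime_add_one_left[of "2 :: int"] by simp
    then have "coprime 3 (int N)"
      by (simp add: N_int)
    then show ?thesis
      using coprime_absorb_left by fastforce
  qed
  have floor: "\<lfloor>real N / 3\<rfloor> = int N div 3"
    using floor_divide_of_int_eq[of "int N" 3, where ?'a = real] by simp

  show "real_of_int (kth_largest k F)
      \<le> real N / sqrt (real k) * sqrt (1 + (2 ^ (k - 1) - 1) / real N)"
    if k: "1 \<le> k \<and> k \<le> N * (N - 1)" for k
  proof -
    let ?L = "real_of_int (kth_largest k F)"
    have "real_of_int (int k * (kth_largest k F)\<^sup>2)
        \<le> real_of_int ((int N)\<^sup>2 + int N * (2 ^ (k - 1) - 1))"
      unfolding of_int_le_iff N_int using kth_largest_square_le[OF assms(3)] k assms(2) by blast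
    then have "?L\<^sup>2 \<le> ((real N)\<^sup>2 + real N * (2 ^ (k - 1) - 1)) / real k"
      using k by (simp add: field_simps)
    also have "\<dots> = (real N)\<^sup>2 / real k * (1 + (2 ^ (k - 1) - 1) / real N)"
      using N16 k by (simp add: field_simps power2_eq_square)
    finally have "?L \<le> sqrt ((real N)\<^sup>2 / real k * (1 + (2 ^ (k - 1) - 1) / real N))"
      by (rule real_le_rsqrt)
    then show ?thesis
      by (simp add: real_sqrt_mult real_sqrt_divide)
  qed

  show "real_of_int (2 * \<lfloor>real N / 3\<rfloor>) < 2 * real N / 3"
  proof -
    have "3 * (int N div 3) < int N"
      using not3 by presburger
    then have "3 * real_of_int (int N div 3) < real N"
      by linarith
    then show ?thesis by (simp add: floor)
  qed

  show "kth_largest 2 F \<le> 2 * \<lfloor>real N / 3\<rfloor>"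
  proof -
    let ?L = "kth_largest 2 F"
    obtain A where A: "card A = 2" "0 \<notin> A" "\<And>c. c \<in> A \<Longrightarrow> ?L \<le> \<bar>walsh F c\<bar>"
      using kth_largest_witnesses[of 2 F] range[of 2] by auto
    then obtain c d where cd: "A = {c, d}" "c \<noteq> d"
      by (auto simp: card_2_iff)
    obtain m where m: "?L = 2 * m"
      using kth_largest_even_nonneg(1)[of 2 F] range[of 2] by auto
    have "3 * ?L \<le> 2 * int N"
    proof (rule ccontr)
      assume "\<not> 3 * ?L \<le> 2 * int N"
      then have large: "2 * int N < 3 * ?L" by simp
      have "?L * (3 * ?L - 2 * int N) \<le> int N"
        unfolding N_int
      proof (rule walsh_two_le[OF assms(3), of c d])
        show "2 ^ CARD('n) \<le> 2 * ?L"
          using large unfolding N_int[symmetric] by linarith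
      qed (use A cd in auto)
      \<comment> \<open>Parity of \<open>?L\<close> turns \<open>3 * ?L - 2 * N > 0\<close> into \<open>3 * ?L - 2 * N \<ge> 2\<close>; a gap of 1 would not contradict.\<close>
      moreover have "?L * 2 \<le> ?L * (3 * ?L - 2 * int N)"
        using large m by (intro mult_left_mono) auto
      ultimately show False using large by linarith
    qed
    then show ?thesis
      unfolding floor m by presburger
  qed

  show "real_of_int (kth_largest 4 F) \<le> real N / 2"
  proof -
    let ?L = "kth_largest 4 F"
    obtain m where m: "?L = 2 * m"
      using kth_largest_even_nonneg(1)[of 4 F] range[of 4] by auto
    obtain q where q: "int N = 4 * q"
      using assms(1) le_imp_power_dvd[of 2 "CARD('n)" "2 :: int"] by (auto simp: N_int)
    have "4 * ?L\<^sup>2 \<le> (int N)\<^sup>2 + int N * 7"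
      using kth_largest_square_le[OF assms(3), of 4] range[of 4] by (simp add: N_int)
    then have "4 * m\<^sup>2 \<le> 4 * q\<^sup>2 + 7 * q"
      by (simp add: m q power_mult_distrib)
    \<comment> \<open>Since \<open>?L = 2 * m\<close> and \<open>N = 4 * q\<close>, it is enough that the integers satisfy \<open>m < q + 1\<close>.\<close>
    moreover have "4 * (q + 1)\<^sup>2 = 4 * q\<^sup>2 + 8 * q + 4"
      by (simp add: power2_eq_square algebra_simps)
    ultimately have "m\<^sup>2 < (q + 1)\<^sup>2"
      using q by linarith
    then have "m < q + 1"
      by (rule power2_less_imp_less) (use q in linarith)
    then have "2 * ?L \<le> int N"
      using m q by simp
    then show ?thesis by linarith
  qed
qed

end
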